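(* For every integer $n>73$, the directed graph $G_n$ of Floridian solitaire contains a $4$-cycle.
   Context: A partition of a positive integer $n$ is a finite multiset of positive integers (its parts) with sum $n$. If $\lambda$ is a partition with $p$ parts, $\Omega(\lambda)$ is the partition obtained by reducing every part by $1$ (parts that become $0$ are discarded) and adding a new part of size $p$ (the $\Omega$-move). A partition is separated if there is no $j>0$ such that both $j$ and $j+1$ occur as parts. $S(n)$ is the set of separated partitions of $n$. $T(n)$ is the set of $\lambda\in S(n)$ such that $\lambda$ has no part of size $p$ or $p+2$, where $p$ is the number of parts of $\lambda$. An $\alpha$-move from $\lambda_1\in S(n)$ to $\lambda_2$: select $s\ge 1$ of the parts of $\lambda_1$ (counted with multiplicity), reduce each selected part by $1$ (discarding zeros), leave the other parts unchanged, and add a new part of size $s$; the result $\lambda_2$ is required to satisfy $\lambda_2\neq\lambda_1$ and $\lambda_2\in T(n)$. $G_n$ is the bipartite directed graph whose nodes are the pairs $[\lambda,\alpha]$ with $\lambda\in S(n)$ and $[\lambda,\Omega]$ with $\lambda\in T(n)$, with an arc $[\lambda_1,\alpha]\to[\lambda_2,\Omega]$ whenever there is an $\alpha$-move from $\lambda_1$ to $\lambda_2\in T(n)$, and an arc $[\lambda_2,\Omega]\to[\Omega(\lambda_2),\alpha]$ for each $\lambda_2\in T(n)$. A $k$-cycle is a directed cycle with $k$ distinct nodes. *)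

theory Defs
  imports "HOL-Library.Multiset" "Graph_Theory.Graph_Theory"
begin

definition is_partition :: "nat \<Rightarrow> nat multiset \<Rightarrow> bool" where
  "is_partition n \<mu> \<longleftrightarrow> (\<forall>j\<in>#\<mu>. 0 < j) \<and> sum_mset \<mu> = n"

definition reduce_parts :: "nat multiset \<Rightarrow> nat multiset" where
  "reduce_parts M = filter_mset (\<lambda>j. 0 < j) (image_mset (\<lambda>j. j - 1) M)"

definition omega_move :: "nat multiset \<Rightarrow> nat multiset" where
  "omega_move \<mu> = add_mset (size \<mu>) (reduce_parts \<mu>)"

definition separated :: "nat multiset \<Rightarrow> bool" where
  "separated \<mu> \<longleftrightarrow> \<not> (\<exists>j>0. j \<in># \<mu> \<and> j + 1 \<in># \<mu>)"

definition S_parts :: "nat \<Rightarrow> nat multiset set" where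
  "S_parts n = {\<mu>. is_partition n \<mu> \<and> separated \<mu>}"

definition T_parts :: "nat \<Rightarrow> nat multiset set" where
  "T_parts n = {\<mu> \<in> S_parts n. size \<mu> \<notin># \<mu> \<and> size \<mu> + 2 \<notin># \<mu>}"

definition alpha_move :: "nat \<Rightarrow> nat multiset \<Rightarrow> nat multiset \<Rightarrow> bool" where
  "alpha_move n \<mu>\<^sub>1 \<mu>\<^sub>2 \<longleftrightarrow>
     \<mu>\<^sub>1 \<in> S_parts n \<and> \<mu>\<^sub>2 \<in> T_parts n \<and> \<mu>\<^sub>2 \<noteq> \<mu>\<^sub>1 \<and>
     (\<exists>M. M \<subseteq># \<mu>\<^sub>1 \<and> 1 \<le> size M \<and>
       \<mu>\<^sub>2 = add_mset (size M) ((\<mu>\<^sub>1 - M) + reduce_parts M))"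

datatype move = Alpha | Omega

definition floridian_graph :: "nat \<Rightarrow> (nat multiset \<times> move) pair_pre_digraph" where
  "floridian_graph n =
     \<lparr> pverts = {(\<mu>, Alpha) | \<mu>. \<mu> \<in> S_parts n} \<union> {(\<mu>, Omega) | \<mu>. \<mu> \<in> T_parts n},
       parcs = {((\<mu>\<^sub>1, Alpha), (\<mu>\<^sub>2, Omega)) | \<mu>\<^sub>1 \<mu>\<^sub>2. alpha_move n \<mu>\<^sub>1 \<mu>\<^sub>2} \<union>
               {((\<mu>\<^sub>2, Omega), (omega_move \<mu>\<^sub>2, Alpha)) | \<mu>\<^sub>2. \<mu>\<^sub>2 \<in> T_parts n} \<rparr>"

text \<open>
  In \<^const>\<open>pre_digraph.cycle\<close> the start vertex is listed again at the end of a closed walk, so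
  its condition \<open>distinct (tl (awalk_verts u p))\<close> says that the \<open>length p\<close> visited nodes are
  pairwise distinct.
\<close>

definition has_k_cycle :: "('a, 'b) pre_digraph \<Rightarrow> nat \<Rightarrow> bool" where
  "has_k_cycle G k \<longleftrightarrow> (\<exists>p. pre_digraph.cycle G p \<and> length p = k)"

end

theory Submission
  imports Defs
begin

text \<open>
  A 4-cycle amounts to \<open>a\<close> and \<open>b\<close> in \<^term>\<open>T_parts n\<close> with \<open>\<Omega>(a) \<noteq> \<Omega>(b)\<close> such that one
  \<open>\<alpha>\<close>-move leads from \<open>\<Omega>(a)\<close> to \<open>b\<close> and another one from \<open>\<Omega>(b)\<close> back to \<open>a\<close>. In such a cycle a
  part that is born at some move shrinks by \<open>1\<close> at both \<open>\<Omega>\<close>-moves of every period and by \<open>0\<close> or \<open>1\<close>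
  at each of the two \<open>\<alpha>\<close>-moves, so that \<open>a\<close> is the union of the four trajectories that start at
  the four newborn parts, sampled once per period.

  The solutions used here have few selected parts. The two parts born at the \<open>\<Omega>\<close>-moves have the
  sizes \<open>p = size a\<close> and \<open>p - 1 = size b\<close>; the larger one has shrunk to the same size when the smaller
  one is born, and from then on the two move down together. Their trajectory is a staircase of
  \<open>R + 1\<close> rows, each with two equal parts, that ends in \<open>\<dots>, 5, 3, 1\<close>. Its step from row \<open>r\<close> to row
  \<open>r + 1\<close> is \<open>2\<close>, increased by one if \<open>r\<close> belongs to a set \<open>A\<close> of rows selected at the first
  \<open>\<alpha>\<close>-move, and by one more if \<open>r\<close> belongs to a set \<open>B\<close> of rows selected at the second one. With
  \<open>\<alpha> = card A\<close> and \<open>\<beta> = card B\<close>, the first \<open>\<alpha>\<close>-move creates a part of size \<open>2 * \<alpha>\<close>. At the second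
  \<open>\<alpha>\<close>-move a single part \<open>1\<close> is selected as well, which creates a part of size \<open>2 * \<beta> + 1\<close>. These two
  small parts are never selected before they have shrunk to \<open>1\<close>. All counts match for every choice
  of \<open>A\<close> and \<open>B\<close>: the number of parts of \<open>a\<close> comes out as \<open>2 * R + 2 + \<alpha> + \<beta>\<close>, which is one more than
  the size of row \<open>0\<close>. The partitions stay separated because, close to the bottom of the staircase,
  all parts have the same parity, and further up the rows keep their distance
  (\<open>has_4_cycle_staircase\<close>).

  Moving a selected row down by one row increases \<open>n\<close> by \<open>2\<close>. Hence for fixed \<open>R, \<alpha>, \<beta>\<close> the sums
  reached are all numbers of one parity in an interval of length about \<open>2 * (\<alpha> + \<beta>) * R\<close>
  (\<open>subset_sum_exists\<close>), starting close to \<open>2 * (R + 1)\<^sup>2\<close>. Consecutive values of \<open>2 * (R + 1)\<^sup>2\<close>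
  differ only by \<open>4 * R + 6\<close>, so that the pairs \<open>(1, 1)\<close> and \<open>(2, 2)\<close> for \<open>(\<alpha>, \<beta>)\<close> cover the even
  numbers and the pairs \<open>(2, 1)\<close> and \<open>(3, 2)\<close> cover the odd ones, except for finitely many. The
  exceptions above \<open>73\<close> are settled by explicit partitions.
\<close>

section \<open>Moves and four-cycles\<close>

lemma reduce_parts_empty [simp]: "reduce_parts {#} = {#}"
  by (simp add: reduce_parts_def)

lemma reduce_parts_union [simp]: "reduce_parts (M + N) = reduce_parts M + reduce_parts N"
  by (simp add: reduce_parts_def)

lemma reduce_parts_add_mset:
  "reduce_parts (add_mset j M) = (if j \<le> 1 then reduce_parts M else add_mset (j - 1) (reduce_parts M))"
  by (auto simp: reduce_parts_def)

lemma reduce_parts_image_mset: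
  assumes "\<And>i. i \<in># I \<Longrightarrow> 2 \<le> f i"
  shows "reduce_parts (image_mset f I) = image_mset (\<lambda>i. f i - 1) I"
  using assms by (induction I) (simp_all add: reduce_parts_add_mset not_less_eq_eq numeral_2_eq_2)

lemma in_reduce_parts_iff: "j \<in># reduce_parts M \<longleftrightarrow> 0 < j \<and> j + 1 \<in># M"
proof
  assume "0 < j \<and> j + 1 \<in># M"
  then show "j \<in># reduce_parts M"
    by (force simp: reduce_parts_def)
qed (auto simp: reduce_parts_def)

lemma sum_reduce_parts:
  assumes "\<forall>j\<in>#M. 0 < j"
  shows "sum_mset (reduce_parts M) + size M = sum_mset M"
  using assms by (induction M) (auto simp: reduce_parts_add_mset)

text \<open>
  The two sizes that membership in \<^const>\<open>T_parts\<close> excludes are those that would become neighbours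
  of the new part.
\<close>
lemma omega_move_in_S_parts:
  assumes "\<mu> \<in> T_parts n" and "0 < n"
  shows "omega_move \<mu> \<in> S_parts n"
proof -
  from assms have pos: "\<forall>j\<in>#\<mu>. 0 < j" and sum: "sum_mset \<mu> = n" and sep: "separated \<mu>"
    and T: "size \<mu> \<notin># \<mu>" "size \<mu> + 2 \<notin># \<mu>"
    by (auto simp: T_parts_def S_parts_def is_partition_def)
  have "0 < size \<mu>"
    using sum \<open>0 < n\<close> by (cases \<mu>) auto
  moreover have "separated (omega_move \<mu>)"
    using sep T by (auto simp: separated_def omega_move_def in_reduce_parts_iff)
  ultimately show ?thesis
    using sum_reduce_parts[OF pos] sum
    by (auto simp: S_parts_def is_partition_def omega_move_def in_reduce_parts_iff)
qed

text \<open>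
  Writing the source as \<open>K + M\<close> with \<open>M\<close> the selected parts avoids multiset differences. Moves
  preserve the sum, so the new partition needs no separate check that it is a partition of \<open>n\<close>.
\<close>
lemma alpha_moveI:
  assumes "\<mu> \<in> S_parts n" and \<mu>: "\<mu> = K + M" and "M \<noteq> {#}"
    and \<nu>: "\<nu> = add_mset (size M) (K + reduce_parts M)" and "\<nu> \<noteq> \<mu>"
    and "separated \<nu>" and "size \<nu> \<notin># \<nu>" and "size \<nu> + 2 \<notin># \<nu>"
  shows "alpha_move n \<mu> \<nu>"
proof -
  have pos: "\<forall>j\<in>#K + M. 0 < j" and sum: "sum_mset (K + M) = n"
    using assms(1) \<mu> by (auto simp: S_parts_def is_partition_def)
  have "0 < size M"
    using \<open>M \<noteq> {#}\<close> by (simp add: nonempty_has_size)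
  have "is_partition n \<nu>"
    using pos sum \<open>0 < size M\<close> sum_reduce_parts[of M]
    by (auto simp: \<nu> is_partition_def in_reduce_parts_iff)
  then have "\<nu> \<in> T_parts n"
    using assms by (simp add: T_parts_def S_parts_def)
  then show ?thesis
    using assms \<open>0 < size M\<close> unfolding alpha_move_def
    by (intro conjI exI[of _ M]) auto
qed

lemma has_4_cycleI:
  assumes ab: "alpha_move n (omega_move a) b" and ba: "alpha_move n (omega_move b) a"
    and "a \<noteq> b" and "omega_move a \<noteq> omega_move b"
  shows "has_k_cycle (with_proj (floridian_graph n)) 4"
proof -
  let ?G = "floridian_graph n"
  let ?p = "[((a, Omega), (omega_move a, Alpha)), ((omega_move a, Alpha), (b, Omega)),
             ((b, Omega), (omega_move b, Alpha)), ((omega_move b, Alpha), (a, Omega))]"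
  from ab ba have T: "a \<in> T_parts n" "b \<in> T_parts n"
    by (auto simp: alpha_move_def)
  have "pre_digraph.awalk (with_proj ?G) (a, Omega) ?p (a, Omega)"
    using T ab ba
    by (auto simp: pre_digraph.awalk_def cas_with_proj_eq floridian_graph_def)
  then have "pre_digraph.cycle (with_proj ?G) ?p"
    unfolding pre_digraph.cycle_def using assms
    by (intro exI[of _ "(a, Omega)"]) (auto simp: awalk_verts_with_proj_eq)
  then show ?thesis
    unfolding has_k_cycle_def by (intro exI[of _ ?p]) simp
qed

section \<open>Staircases and arithmetic progressions of parts\<close>

lemma mset_set_split:
  assumes "finite I" "B \<subseteq> I"
  shows "mset_set I = mset_set (I - B) + mset_set B"
  using mset_set_Union[of "I - B" B] assms finite_subset[of B I]
  by (simp add: Un_absorb2 Diff_Int_distrib2)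

text \<open>
  Reducing the selected members of an indexed family of parts amounts to changing the indexed
  function; the bound guarantees that no part vanishes.
\<close>
lemma alpha_image_mset:
  assumes "finite I" "B \<subseteq> I" "\<And>i. i \<in> B \<Longrightarrow> 2 \<le> f i"
  shows "image_mset f (mset_set (I - B)) + reduce_parts (image_mset f (mset_set B))
           = image_mset (\<lambda>i. f i - of_bool (i \<in> B)) (mset_set I)"
proof -
  have "finite B" using assms finite_subset by blast
  have "reduce_parts (image_mset f (mset_set B)) = image_mset (\<lambda>i. f i - of_bool (i \<in> B)) (mset_set B)"
    using assms \<open>finite B\<close> by (subst reduce_parts_image_mset) (auto intro!: image_mset_cong)
  moreover have "image_mset f (mset_set (I - B)) = image_mset (\<lambda>i. f i - of_bool (i \<in> B)) (mset_set (I - B))"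
    using assms by (auto intro!: image_mset_cong)
  ultimately show ?thesis
    by (simp add: mset_set_split[OF assms(1,2)])
qed

text \<open>
  The closed form counts, from the bottom row \<open>R\<close> of size \<open>1\<close> upwards, a step of \<open>2\<close> per row and the
  extra units at the rows of \<open>A\<close> and \<open>B\<close>; the recursion is \<open>row_Suc\<close> below.
\<close>
definition row :: "nat \<Rightarrow> nat set \<Rightarrow> nat set \<Rightarrow> nat \<Rightarrow> nat" where
  "row R A B r = 1 + 2 * (R - r) + card {g \<in> A. r \<le> g} + card {g \<in> B. r \<le> g}"

definition odds :: "nat \<Rightarrow> nat multiset" where
  "odds k = image_mset (\<lambda>i. 2 * i + 1) (mset_set {..<k})"

definition evens :: "nat \<Rightarrow> nat multiset" where
  "evens k = image_mset (\<lambda>i. 2 * i + 2) (mset_set {..<k})"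

lemma odds_Suc: "odds (Suc k) = add_mset (2 * k + 1) (odds k)"
  by (simp add: odds_def lessThan_Suc)

lemma evens_Suc: "evens (Suc k) = add_mset (2 * k + 2) (evens k)"
  by (simp add: evens_def lessThan_Suc)

lemma size_odds [simp]: "size (odds k) = k" and size_evens [simp]: "size (evens k) = k"
  by (simp_all add: odds_def evens_def)

lemma one_in_odds: "0 < k \<Longrightarrow> 1 \<in># odds k"
  by (induction k) (auto simp: odds_Suc)

lemma sum_odds: "sum_mset (odds k) = k * k"
  by (induction k) (simp_all add: odds_Suc, simp add: odds_def)

lemma reduce_parts_evens: "reduce_parts (evens k) = odds k"
  unfolding evens_def odds_def by (subst reduce_parts_image_mset) auto

lemma reduce_parts_odds: "reduce_parts (odds (Suc k)) = evens k"
  by (induction k) (simp_all add: odds_Suc evens_Suc reduce_parts_add_mset, simp add: odds_def evens_def)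

lemma card_ge_Suc:
  assumes "finite A"
  shows "card {g \<in> A. r \<le> g} = card {g \<in> A. Suc r \<le> g} + of_bool (r \<in> A)"
proof (cases "r \<in> A")
  case True
  then have "{g \<in> A. r \<le> g} = insert r {g \<in> A. Suc r \<le> g}" by auto
  then show ?thesis using assms True by simp
next
  case False
  then have "{g \<in> A. r \<le> g} = {g \<in> A. Suc r \<le> g}" by (auto simp: Suc_le_eq order_less_le)
  then show ?thesis using False by simp
qed

lemma row_Suc:
  assumes "finite A" "finite B" "r < R"
  shows "row R A B r = row R A B (Suc r) + 2 + of_bool (r \<in> A) + of_bool (r \<in> B)"
  using assms card_ge_Suc[of A r] card_ge_Suc[of B r] by (simp add: row_def)

lemma sum_card_ge:
  assumes "A \<subseteq> {..<R}"
  shows "(\<Sum>r<R. card {g \<in> A. r \<le> g}) = (\<Sum>g\<in>A. Suc g)"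
proof -
  have "finite A" using assms finite_subset by blast
  have "(\<Sum>r<R. card {g \<in> A. r \<le> g}) = (\<Sum>r<R. \<Sum>g\<in>A. of_bool (r \<le> g))"
    using \<open>finite A\<close> by (simp add: Int_def)
  also have "\<dots> = (\<Sum>g\<in>A. \<Sum>r<R. of_bool (r \<le> g))"
    by (rule sum.swap)
  also have "\<dots> = (\<Sum>g\<in>A. Suc g)"
  proof (rule sum.cong[OF refl])
    fix g assume "g \<in> A"
    then have "{..<R} \<inter> {r. r \<le> g} = {..g}" using assms by auto
    then show "(\<Sum>r<R. of_bool (r \<le> g)) = Suc g" by simp
  qed
  finally show ?thesis .
qed

text \<open>
  A member \<open>g\<close> of \<open>A\<close> or \<open>B\<close> raises the rows \<open>0, \<dots>, g\<close> by one, so it contributes \<open>g + 1\<close>. The bottom row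
  \<open>R\<close> is left out.
\<close>
lemma sum_row:
  assumes "A \<subseteq> {..<R}" "B \<subseteq> {..<R}"
  shows "(\<Sum>r<R. row R A B r) = R * (R + 2) + (\<Sum>g\<in>A. Suc g) + (\<Sum>g\<in>B. Suc g)"
proof -
  have "(\<Sum>r<R. 1 + 2 * (R - r)) = R * (R + 2)"
  proof (induction R)
    case (Suc R)
    then show ?case by (subst sum.lessThan_Suc_shift) simp
  qed simp
  then show ?thesis
    by (simp only: row_def sum.distrib sum_card_ge[OF assms(1)] sum_card_ge[OF assms(2)])
qed

section \<open>The cycle of a staircase\<close>

text \<open>
  The distance stays at least \<open>2\<close> even after row \<open>r\<close> has been reduced at the first \<open>\<alpha>\<close>-move, which is
  the form needed for the intermediate partition \<open>b\<close>.
\<close>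
lemma row_gap:
  assumes "finite A" "finite B" "r < r'" "r' \<le> R"
  shows "row R A B r' + 2 \<le> row R A B r - of_bool (r \<in> A)"
  using Suc_leI[OF assms(3)] assms(4)
proof (induction r' rule: dec_induct)
  case base
  then show ?case using row_Suc[of A B r R] assms by simp
next
  case (step m)
  then show ?case using row_Suc[of A B m R] assms by simp
qed

lemma row_eq:
  assumes "A \<subseteq> {..<L}" "B \<subseteq> {..<L}" "L \<le> r"
  shows "row R A B r = 1 + 2 * (R - r)"
proof -
  have empty: "{g \<in> A. r \<le> g} = {}" "{g \<in> B. r \<le> g} = {}"
    using assms by auto
  show ?thesis unfolding row_def empty by simp
qed

text \<open>
  Small parts cannot be neighbours because they share their parity \<open>e\<close>, and the set \<open>H\<close> of large parts
  is assumed to keep a distance from them.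
\<close>
lemma separated_lowI:
  assumes parts: "\<And>j. j \<in># M \<Longrightarrow> j \<le> m \<and> even j = e \<or> j \<in> H"
    and "\<And>h. h \<in> H \<Longrightarrow> m + 2 \<le> h" and "\<And>h. h \<in> H \<Longrightarrow> h + 1 \<notin> H"
  shows "separated M"
  unfolding separated_def
proof safe
  fix j assume "j \<in># M" "j + 1 \<in># M"
  from parts[OF this(1)] parts[OF this(2)] show False
    using assms(2)[of j] assms(2)[of "j + 1"] assms(3)[of j] by auto
qed

text \<open>
  The parity of the multiplicity of \<open>s\<close> distinguishes both sides. This rules out that the second
  \<open>\<alpha>\<close>-move reproduces the partition it starts from.
\<close>
lemma double_plus_single_neq:
  fixes X Y :: "nat multiset"
  assumes "j \<noteq> s"
  shows "add_mset s (X + X) \<noteq> add_mset j (Y + Y)"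
proof
  assume eq: "add_mset s (X + X) = add_mset j (Y + Y)"
  from arg_cong[OF eq, of "\<lambda>M. even (count M s)"] \<open>j \<noteq> s\<close>
  show False by simp
qed

text \<open>
  The last \<open>K\<close> steps of the staircase are plain steps of \<open>2\<close>, which is where the bounds on \<open>A\<close> and \<open>B\<close>
  come from: the trajectories of the newborn parts of sizes \<open>2 * card A\<close> and \<open>2 * card B + 1\<close> lie in
  this zone, in which all parts of \<open>a\<close> are odd and all parts of \<open>b\<close> are even. The sets \<open>A\<close> and \<open>B\<close> must
  be nonempty: an \<open>\<alpha>\<close>-move has to select something, and the selection of a lone part \<open>1\<close> would
  recreate that part.
\<close>
lemma has_4_cycle_staircase:
  fixes R K n :: nat and A B :: "nat set"
  assumes A: "A \<subseteq> {..<R - K}" "1 \<le> card A" "card A \<le> K"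
    and B: "B \<subseteq> {..<R - K}" "1 \<le> card B" "card B \<le> K"
    and n: "n + 1 = 2 * (R + 1)\<^sup>2 + 2 * ((\<Sum>g\<in>A. Suc g) + (\<Sum>g\<in>B. Suc g))
              + (card A)\<^sup>2 + (card B + 1)\<^sup>2"
  shows "has_k_cycle (with_proj (floridian_graph n)) 4"
proof -
  define \<alpha> \<beta> where "\<alpha> = card A" and "\<beta> = card B"
  define p where "p = 2 * R + 2 + \<alpha> + \<beta>"
  define x where "x = row R A B"
  define I where "I = mset_set {..<R}"
  define X where "X = image_mset x I"
  define Y where "Y = image_mset (\<lambda>r. x r - 1) I"
  define Y' where "Y' = image_mset (\<lambda>r. x r - 1 - of_bool (r \<in> A)) I"
  define Z where "Z = image_mset (\<lambda>r. x r - 2 - of_bool (r \<in> A)) I"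
  \<comment> \<open>The single \<open>1\<close> combines the two parts of the bottom row with the missing \<open>1\<close> of the small
    trajectories, which was consumed at the second \<open>\<alpha>\<close>-move.\<close>
  define a where "a = add_mset 1 (X + X + odds \<alpha> + odds (Suc \<beta>))"
  define b where "b = add_mset p (Y' + Y' + evens \<alpha> + evens \<beta>)"
  have fin: "finite A" "finite B"
    using A B finite_subset by blast+
  have "K < R"
    using A(1,2) by (cases "K < R") auto
  have AB: "A \<subseteq> {..<R}" "B \<subseteq> {..<R}"
    using A B by auto
  have x_Suc: "x r = x (Suc r) + 2 + of_bool (r \<in> A) + of_bool (r \<in> B)" if "r < R" for r
    using row_Suc[OF fin that] by (simp add: x_def)
  have x_gap: "x r' + 2 \<le> x r - of_bool (r \<in> A)" if "r < r'" "r' \<le> R" for r r'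
    using row_gap[OF fin that] by (simp add: x_def)
  have x_cases: "x r = x r' \<and> (of_bool (r \<in> A) :: nat) = of_bool (r' \<in> A)
      \<or> x r' + 2 \<le> x r - of_bool (r \<in> A) \<or> x r + 2 \<le> x r' - of_bool (r' \<in> A)"
    if "r < R" "r' < R" for r r'
    using x_gap[of r r'] x_gap[of r' r] that by (cases r r' rule: linorder_cases) simp_all
  have x_low: "x r = 1 + 2 * (R - r)" if "R - K \<le> r" for r
    using row_eq[OF A(1) B(1) that] by (simp add: x_def)
  have x_high: "2 * K + 3 + of_bool (r \<in> A) \<le> x r" if "r < R - K" for r
    using x_gap[of r "R - K"] x_low[of "R - K"] that \<open>K < R\<close> by auto
  have x_R: "x R = 1"
    using x_low[of R] by simp
  have x_0: "x 0 = p - 1"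
  proof -
    have "{g \<in> A. 0 \<le> g} = A" "{g \<in> B. 0 \<le> g} = B" by auto
    then show ?thesis unfolding x_def row_def p_def \<alpha>_def \<beta>_def by simp
  qed
  have x_top: "x r < p" if "r < R" for r
    using x_0 x_gap[of 0 r] that p_def by (cases "r = 0") auto
  have x_3: "3 + of_bool (r \<in> A) + of_bool (r \<in> B) \<le> x r" if "r < R" for r
    using x_Suc[OF that] x_gap[of "Suc r" R] x_R that by (cases "Suc r = R") auto

  have size_a: "size a = p"
    by (simp add: a_def X_def I_def p_def)
  have size_b: "size b = p - 1"
    by (simp add: b_def Y'_def I_def p_def)
  have omega_a: "omega_move a = add_mset p (Y + Y + evens (\<alpha> - 1) + evens \<beta>)"
  proof -
    have "reduce_parts X = Y"
      unfolding X_def Y_def I_def by (rule reduce_parts_image_mset) (use x_3 in force)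
    moreover have "reduce_parts (odds \<alpha>) = evens (\<alpha> - 1)"
      using A(2) reduce_parts_odds[of "\<alpha> - 1"] by (simp add: \<alpha>_def)
    ultimately show ?thesis
      unfolding omega_move_def size_a by (simp add: a_def reduce_parts_add_mset reduce_parts_odds)
  qed
  have omega_b: "omega_move b = add_mset (p - 1) (add_mset (p - 1) (Z + Z + odds \<alpha> + odds \<beta>))"
  proof -
    have "reduce_parts Y' = image_mset (\<lambda>r. x r - 1 - of_bool (r \<in> A) - 1) I"
      unfolding Y'_def I_def by (rule reduce_parts_image_mset) (use x_3 in force)
    also have "\<dots> = Z"
      unfolding Z_def by (auto intro!: image_mset_cong)
    finally show ?thesis
      unfolding omega_move_def size_b
      by (simp add: b_def reduce_parts_add_mset reduce_parts_evens p_def)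
  qed

  have low_or_high_a: "(odd j \<and> j \<le> 2 * K + 1) \<or> (\<exists>r<R - K. j = x r)" if "j \<in># a" for j
  proof -
    from that consider "j = 1" | r where "r < R" "j = x r" | "j \<in># odds \<alpha>" | "j \<in># odds (Suc \<beta>)"
      unfolding a_def X_def I_def by auto
    then show ?thesis
    proof cases
      case (2 r)
      then show ?thesis using x_low[of r] by (cases "r < R - K") auto
    qed (use A(3) B(3) in \<open>auto simp: odds_def \<alpha>_def \<beta>_def\<close>)
  qed
  have sep_a: "separated a"
  proof (rule separated_lowI[where m = "2 * K + 1" and e = False and H = "x ` {..<R - K}"])
    fix h assume "h \<in> x ` {..<R - K}"
    then obtain r where r: "r < R - K" "h = x r" by auto
    show "2 * K + 1 + 2 \<le> h"
      using x_high[OF r(1)] r(2) by simp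
    show "h + 1 \<notin> x ` {..<R - K}"
    proof
      assume "h + 1 \<in> x ` {..<R - K}"
      then obtain r' where r': "r' < R - K" "x r' = h + 1" by auto
      show False
        using x_cases[of r r'] r r' \<open>K < R\<close> by linarith
    qed
  qed (use low_or_high_a in auto)
  have p_big: "2 * K + 2 \<le> p"
    using \<open>K < R\<close> by (simp add: p_def)
  have low_or_high_b: "(even j \<and> j \<le> 2 * K) \<or> (\<exists>r<R - K. j = x r - 1 - of_bool (r \<in> A))"
    if "j \<in># b" "j \<noteq> p" for j
  proof -
    from that consider r where "r < R" "j = x r - 1 - of_bool (r \<in> A)"
      | "j \<in># evens \<alpha>" | "j \<in># evens \<beta>"
      unfolding b_def Y'_def I_def by auto
    then show ?thesis
    proof cases
      case (1 r)
      have "r \<notin> A" if "R - K \<le> r" using A(1) that by auto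
      then show ?thesis using 1 x_low[of r] by (cases "r < R - K") auto
    qed (use A(3) B(3) in \<open>auto simp: evens_def \<alpha>_def \<beta>_def\<close>)
  qed
  have b_top: "j + 2 \<le> p" if "j \<in># b" "j \<noteq> p" for j
    using low_or_high_b[OF that]
  proof (elim disjE exE conjE)
    fix r assume r: "r < R - K" "j = x r - 1 - of_bool (r \<in> A)"
    then have "r < R" by linarith
    then show ?thesis using x_top[of r] x_high[of r] r by linarith
  qed (use p_big in auto)
  have sep_b: "separated b"
  proof (rule separated_lowI[where m = "2 * K" and e = True
        and H = "insert p ((\<lambda>r. x r - 1 - of_bool (r \<in> A)) ` {..<R - K})"])
    fix h assume "h \<in> insert p ((\<lambda>r. x r - 1 - of_bool (r \<in> A)) ` {..<R - K})"
    then consider "h = p" | r where "r < R - K" "h = x r - 1 - of_bool (r \<in> A)" by auto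
    then have "2 * K + 2 \<le> h \<and> h + 1 \<notin> insert p ((\<lambda>r. x r - 1 - of_bool (r \<in> A)) ` {..<R - K})"
    proof cases
      case 1
      have "p + 1 \<noteq> x r - 1 - of_bool (r \<in> A)" if "r < R - K" for r
        using x_top[of r] that by linarith
      with 1 p_big show ?thesis by auto
    next
      case (2 r)
      have "h + 1 \<noteq> p"
        using 2 x_top[of r] x_high[of r] by linarith
      moreover have "h + 1 \<noteq> x r' - 1 - of_bool (r' \<in> A)" if "r' < R - K" for r'
        using x_cases[of r r'] x_high[OF that] x_high[OF 2(1)] that 2 \<open>K < R\<close> by linarith
      moreover have "2 * K + 2 \<le> h"
        using 2 x_high[of r] by auto
      ultimately show ?thesis by auto
    qed
    then show "2 * K + 2 \<le> h"
      and "h + 1 \<notin> insert p ((\<lambda>r. x r - 1 - of_bool (r \<in> A)) ` {..<R - K})" by auto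
  qed (use low_or_high_b in auto)
  have a_top: "j < p" if "j \<in># a" for j
    using low_or_high_a[OF that] x_top \<open>K < R\<close> p_big by auto

  have "a \<in> T_parts n"
  proof -
    have "sum_mset X = (\<Sum>r<R. x r)"
      by (simp add: X_def I_def sum_unfold_sum_mset)
    also have "\<dots> = R * (R + 2) + (\<Sum>g\<in>A. Suc g) + (\<Sum>g\<in>B. Suc g)"
      unfolding x_def by (rule sum_row[OF AB])
    finally have "sum_mset a = n"
      using n by (simp add: a_def sum_odds \<alpha>_def \<beta>_def power2_eq_square algebra_simps)
    moreover have "0 < j" if "j \<in># a" for j
      using low_or_high_a[OF that] x_high by (force simp: odd_pos)
    ultimately show ?thesis
      using sep_a a_top[of p] a_top[of "p + 2"] by (auto simp: T_parts_def S_parts_def is_partition_def size_a)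
  qed
  moreover have "0 < n"
    using n by (cases n) (auto simp: power2_eq_square)
  ultimately have omega_a_S: "omega_move a \<in> S_parts n"
    by (rule omega_move_in_S_parts)

  have ab: "alpha_move n (omega_move a) b"
  proof (rule alpha_moveI)
    let ?M = "image_mset (\<lambda>r. x r - 1) (mset_set A)"
    let ?K = "image_mset (\<lambda>r. x r - 1) (mset_set ({..<R} - A))"
    have I: "I = mset_set ({..<R} - A) + mset_set A"
      unfolding I_def using AB by (intro mset_set_split) auto
    show "omega_move a = add_mset p (?K + ?K + evens (\<alpha> - 1) + evens \<beta>) + (?M + ?M)"
      unfolding omega_a Y_def I by simp
    have "?K + reduce_parts ?M = Y'"
      unfolding Y'_def I_def using x_3 AB by (intro alpha_image_mset) force+
    moreover have "evens \<alpha> = add_mset (2 * \<alpha>) (evens (\<alpha> - 1))"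
      using A(2) evens_Suc[of "\<alpha> - 1"] by (simp add: \<alpha>_def)
    ultimately show "b = add_mset (size (?M + ?M))
        (add_mset p (?K + ?K + evens (\<alpha> - 1) + evens \<beta>) + reduce_parts (?M + ?M))"
      by (auto simp: b_def \<alpha>_def ac_simps)
    show "?M + ?M \<noteq> {#}"
      using A(2) fin by (auto simp: mset_set_empty_iff)
    \<comment> \<open>The first \<open>\<alpha>\<close>-move destroys no part, so it increases the number of parts.\<close>
    have "size b \<noteq> size (omega_move a)"
      unfolding size_b omega_a using A(2) by (simp add: Y_def I_def p_def \<alpha>_def)
    then show "b \<noteq> omega_move a" by auto
    have "j \<notin># b" if "p \<le> j + 1" "j \<noteq> p" for j
      using b_top[of j] that by auto
    then show "size b \<notin># b" "size b + 2 \<notin># b"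
      unfolding size_b using p_big by simp_all
  qed (use omega_a_S sep_b in auto)
  then have "b \<in> T_parts n" by (simp add: alpha_move_def)
  then have omega_b_S: "omega_move b \<in> S_parts n"
    using \<open>0 < n\<close> by (rule omega_move_in_S_parts)

  obtain D where D: "odds \<alpha> = add_mset 1 D"
    using one_in_odds[of \<alpha>] A(2) multi_member_split[of 1 "odds \<alpha>"] by (auto simp: \<alpha>_def)
  have ba: "alpha_move n (omega_move b) a"
  proof (rule alpha_moveI)
    let ?M = "image_mset (\<lambda>r. x r - 2 - of_bool (r \<in> A)) (mset_set B)"
    let ?K = "image_mset (\<lambda>r. x r - 2 - of_bool (r \<in> A)) (mset_set ({..<R} - B))"
    have I: "I = mset_set ({..<R} - B) + mset_set B"
      unfolding I_def using AB by (intro mset_set_split) auto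
    let ?K' = "add_mset (p - 1) (add_mset (p - 1) (?K + ?K + D + odds \<beta>))"
    let ?M' = "add_mset 1 (?M + ?M)"
    show \<mu>: "omega_move b = ?K' + ?M'"
      unfolding omega_b Z_def I D by simp
    have "?K + reduce_parts ?M = image_mset (\<lambda>r. x r - 2 - of_bool (r \<in> A) - of_bool (r \<in> B)) I"
      unfolding I_def using x_3 AB by (intro alpha_image_mset) force+
    also have "\<dots> = image_mset (\<lambda>r. x (Suc r)) I"
      by (rule image_mset_cong) (auto simp: I_def x_Suc)
    finally have next_row: "?K + reduce_parts ?M = image_mset (\<lambda>r. x (Suc r)) I" .
    \<comment> \<open>The newborn pair \<open>p - 1, p - 1\<close> becomes row \<open>0\<close>, and every other row has moved to the next one.\<close>
    have shift: "add_mset (p - 1) (image_mset (\<lambda>r. x (Suc r)) I) = add_mset 1 X"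
    proof -
      have "add_mset (x 0) (image_mset (\<lambda>r. x (Suc r)) I) = image_mset x (mset_set {..<Suc R})"
        unfolding lessThan_Suc_eq_insert_0 I_def
        by (subst mset_set.insert) (auto simp: image_mset_mset_set[symmetric] multiset.map_comp o_def)
      also have "\<dots> = add_mset 1 X"
        by (simp add: lessThan_Suc X_def I_def x_R)
      finally show ?thesis by (simp add: x_0)
    qed
    have "add_mset (size ?M') (?K' + reduce_parts ?M')
        = add_mset (2 * \<beta> + 1) (add_mset (p - 1) (?K + reduce_parts ?M)
            + add_mset (p - 1) (?K + reduce_parts ?M) + D + odds \<beta>)"
      by (simp add: reduce_parts_add_mset \<beta>_def mult_2 ac_simps)
    also have "\<dots> = a"
      unfolding next_row shift a_def odds_Suc D by (simp add: ac_simps)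
    finally show a: "a = add_mset (size ?M') (?K' + reduce_parts ?M')" by simp
    have "j \<notin># a" if "p \<le> j" for j
      using a_top[of j] that by auto
    then show "size a \<notin># a" "size a + 2 \<notin># a"
      unfolding size_a by simp_all
    show "a \<noteq> omega_move b"
    proof
      assume "a = omega_move b"
      then have "add_mset (size ?M') (reduce_parts ?M + reduce_parts ?M) = add_mset 1 (?M + ?M)"
        using a \<mu> by (simp add: reduce_parts_add_mset)
      moreover have "1 \<noteq> size ?M'"
        using B(2) by simp
      ultimately show False
        using double_plus_single_neq[OF \<open>1 \<noteq> size ?M'\<close>] by blast
    qed
  qed (use omega_b_S sep_a in auto)

  \<comment> \<open>The part \<open>p\<close> occurs in \<open>\<Omega>(a)\<close> and \<open>b\<close> only.\<close>
  have "p \<in># omega_move a" by (simp add: omega_a)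
  moreover have "p \<notin># omega_move b"
    using b_top[of "p + 1"] p_big by (auto simp: omega_move_def size_b in_reduce_parts_iff)
  moreover have "p \<in># b" "p \<notin># a"
    using a_top by (auto simp: b_def)
  ultimately show ?thesis
    using ab ba by (intro has_4_cycleI[of n a b]) auto
qed

section \<open>Sporadic cycles\<close>

definition expand :: "(nat \<times> nat) list \<Rightarrow> nat list" where
  "expand ps = concat (map (\<lambda>(j, m). replicate m j) ps)"

text \<open>
  Partitions are represented by lists of parts here, so that moves can be evaluated by rewriting;
  \<^const>\<open>sort\<close> decides equality of the underlying multisets.
\<close>
definition reduce_list :: "nat list \<Rightarrow> nat list" where
  "reduce_list xs = filter (\<lambda>j. 0 < j) (map (\<lambda>j. j - 1) xs)"

definition in_T_list :: "nat list \<Rightarrow> bool" where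
  "in_T_list xs \<longleftrightarrow> list_all (\<lambda>j. 0 < j \<and> j + 1 \<notin> set xs \<and> j \<noteq> length xs \<and> j \<noteq> length xs + 2) xs"

definition omega_list :: "nat list \<Rightarrow> nat list" where
  "omega_list xs = length xs # reduce_list xs"

definition alpha_list :: "nat list \<Rightarrow> nat list \<Rightarrow> nat list \<Rightarrow> bool" where
  "alpha_list xs ms ys \<longleftrightarrow>
     (let ks = fold remove1 ms xs in
      sort xs = sort (ks @ ms) \<and> ms \<noteq> [] \<and>
      sort ys = sort (length ms # ks @ reduce_list ms) \<and> sort ys \<noteq> sort xs)"

text \<open>
  A witness consists of \<open>a\<close>, the parts selected in \<open>\<Omega>(a)\<close>, the resulting \<open>b\<close>, and the parts selected in
  \<open>\<Omega>(b)\<close>, all in exponent notation as lists of pairs (size, multiplicity).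
\<close>
fun witness :: "(nat \<times> nat) list \<times> (nat \<times> nat) list \<times> (nat \<times> nat) list \<times> (nat \<times> nat) list \<Rightarrow> bool" where
  "witness (as, ms, bs, ns) \<longleftrightarrow>
     (let a = expand as; b = expand bs in
      a \<noteq> [] \<and> in_T_list a \<and> in_T_list b \<and> sum_list b = sum_list a \<and> sort a \<noteq> sort b \<and> sort (omega_list a) \<noteq> sort (omega_list b) \<and>
      alpha_list (omega_list a) (expand ms) b \<and> alpha_list (omega_list b) (expand ns) a)"

text \<open>
  One witness for each number above \<open>73\<close> that the four families of staircases in the last section
  miss for \<open>R \<ge> 5\<close>.
\<close>
definition sporadic :: "((nat \<times> nat) list \<times> (nat \<times> nat) list \<times> (nat \<times> nat) list \<times> (nat \<times> nat) list) list" where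
  "sporadic = [
   ([(11,2), (8,3), (5,4), (2,4)],
    [(13,1), (10,2), (1,4)],
    [(12,1), (9,2), (7,4), (4,4)],
    [(6,4), (3,4)]),
   ([(12,2), (9,2), (7,2), (4,4), (1,3)],
    [(11,2), (3,4)],
    [(13,1), (10,2), (8,2), (6,3), (2,4)],
    [(5,3), (1,1)]),
   ([(10,2), (8,3), (6,4), (2,4)],
    [(13,1), (5,4), (1,4)],
    [(12,1), (9,3), (7,3), (4,4)],
    [(11,2), (3,4)]),
   ([(12,2), (10,2), (7,2), (4,4), (1,3)],
    [(9,2), (3,4)],
    [(13,1), (11,2), (8,2), (6,3), (2,4)],
    [(5,3), (1,1)]),
   ([(12,2), (10,2), (7,2), (4,3), (2,4)],
    [(1,3)],
    [(13,1), (11,2), (9,2), (6,2), (3,4), (1,1)],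
    [(8,2), (5,2)]),
   ([(12,2), (10,2), (8,2), (4,4), (1,3)],
    [(7,2), (3,4)],
    [(13,1), (11,2), (9,2), (6,3), (2,4)],
    [(5,3), (1,1)]),
   ([(12,2), (10,2), (7,2), (5,3), (2,4)],
    [(4,3), (1,3)],
    [(13,1), (11,2), (9,2), (6,3), (3,3), (1,1)],
    [(8,2)]),
   ([(12,2), (9,2), (7,3), (4,3), (2,4)],
    [(14,1), (6,3), (1,4)],
    [(13,1), (11,2), (8,3), (5,3), (3,3)],
    [(10,2)]),
   ([(13,2), (9,2), (7,3), (4,3), (2,4)],
    [(12,2), (6,3), (1,3)],
    [(14,1), (11,2), (8,3), (5,3), (3,3), (1,1)],
    [(10,2)]),
   ([(13,2), (11,2), (9,2), (6,2), (4,2), (2,4)],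
    [(1,3)],
    [(14,1), (12,2), (10,2), (8,2), (5,2), (3,3), (1,1)],
    [(7,2)]),
   ([(14,2), (12,2), (9,2), (6,2), (3,4), (1,3)],
    [(11,2), (5,2)],
    [(15,1), (13,2), (10,2), (8,2), (4,3), (2,4)],
    [(7,2), (1,1)]),
   ([(14,2), (12,2), (10,2), (6,2), (3,4), (1,3)],
    [(9,2), (5,2)],
    [(15,1), (13,2), (11,2), (8,2), (4,3), (2,4)],
    [(7,2), (1,1)]),
   ([(12,2), (10,3), (8,3), (5,3), (2,4)],
    [(15,1), (7,3), (4,3), (1,4)],
    [(14,1), (11,3), (9,3), (6,3), (3,3)],
    [(13,2)]),
   ([(14,2), (12,2), (9,2), (7,2), (4,4), (1,3)],
    [(11,2), (3,4)],
    [(15,1), (13,2), (10,2), (8,2), (6,3), (2,4)],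
    [(5,3), (1,1)]),
   ([(14,2), (12,2), (10,2), (7,2), (4,4), (1,3)],
    [(9,2), (3,4)],
    [(15,1), (13,2), (11,2), (8,2), (6,3), (2,4)],
    [(5,3), (1,1)]),
   ([(14,2), (12,2), (10,2), (8,2), (4,4), (1,3)],
    [(7,2), (3,4)],
    [(15,1), (13,2), (11,2), (9,2), (6,3), (2,4)],
    [(5,3), (1,1)]),
   ([(14,2), (12,2), (10,2), (7,2), (5,3), (2,4)],
    [(4,3), (1,3)],
    [(15,1), (13,2), (11,2), (9,2), (6,3), (3,3), (1,1)],
    [(8,2)]),
   ([(14,2), (12,2), (9,2), (7,3), (4,3), (2,4)],
    [(16,1), (6,3), (1,4)],
    [(15,1), (13,2), (11,2), (8,3), (5,3), (3,3)],
    [(10,2)]),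
   ([(14,2), (12,2), (10,3), (8,3), (5,3), (2,4)],
    [(17,1), (7,3), (4,3), (1,4)],
    [(16,1), (13,2), (11,3), (9,3), (6,3), (3,3)],
    [(15,2)]),
   ([(15,2), (12,2), (10,3), (8,3), (5,3), (2,4)],
    [(17,1), (7,3), (4,3), (1,4)],
    [(16,1), (14,2), (11,3), (9,3), (6,3), (3,3)],
    [(13,2)]),
   ([(16,2), (14,2), (12,2), (10,2), (8,2), (4,4), (1,3)],
    [(7,2), (3,4)],
    [(17,1), (15,2), (13,2), (11,2), (9,2), (6,3), (2,4)],
    [(5,3), (1,1)]),
   ([(16,2), (14,2), (12,2), (10,2), (7,2), (5,3), (2,4)],
    [(4,3), (1,3)],
    [(17,1), (15,2), (13,2), (11,2), (9,2), (6,3), (3,3), (1,1)],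
    [(8,2)])]"

lemma list_all_witness_sporadic: "list_all witness sporadic"
  by code_simp

lemma sums_sporadic:
  "map (\<lambda>w. sum_list (expand (fst w))) sporadic
     = [74, 75, 76, 77, 78, 79, 81, 83, 85, 94, 97, 99, 101, 103, 105, 107, 109, 111, 129, 131, 139, 141]"
  by code_simp

lemma mset_reduce_list [simp]: "mset (reduce_list xs) = reduce_parts (mset xs)"
  by (simp add: reduce_list_def reduce_parts_def)

lemma mset_omega_list: "mset (omega_list xs) = omega_move (mset xs)"
  by (simp add: omega_list_def omega_move_def)

lemma mset_eq_iff_sort_eq: "mset xs = mset ys \<longleftrightarrow> sort xs = sort ys"
  by (metis mset_sort properties_for_sort sorted_sort)

lemma in_T_listD:
  assumes "in_T_list xs"
  shows "mset xs \<in> T_parts (sum_list xs)"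
proof -
  from assms have "\<forall>j\<in>set xs. 0 < j \<and> j + 1 \<notin> set xs \<and> j \<noteq> length xs \<and> j \<noteq> length xs + 2"
    by (simp add: in_T_list_def list_all_iff)
  then show ?thesis
    by (auto simp: T_parts_def S_parts_def is_partition_def separated_def sum_mset_sum_list)
qed

lemma alpha_listD:
  assumes "alpha_list xs ms ys" and "mset xs \<in> S_parts n" and "mset ys \<in> T_parts n"
  shows "alpha_move n (mset xs) (mset ys)"
proof -
  define ks where "ks = fold remove1 ms xs"
  from assms(1) have "sort xs = sort (ks @ ms)" "ms \<noteq> []"
      "sort ys = sort (length ms # ks @ reduce_list ms)" "sort ys \<noteq> sort xs"
    unfolding alpha_list_def Let_def ks_def by auto
  then have "mset xs = mset ks + mset ms" "mset ms \<noteq> {#}"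
      "mset ys = add_mset (size (mset ms)) (mset ks + reduce_parts (mset ms))" "mset ys \<noteq> mset xs"
    unfolding mset_eq_iff_sort_eq[symmetric] by simp_all
  then show ?thesis
    using assms(2,3) by (intro alpha_moveI) (auto simp: T_parts_def S_parts_def)
qed

lemma has_4_cycle_witness:
  assumes "witness w"
  shows "has_k_cycle (with_proj (floridian_graph (sum_list (expand (fst w))))) 4"
proof -
  obtain as ms bs ns where w: "w = (as, ms, bs, ns)"
    by (cases w) auto
  define a b n where "a = expand as" and "b = expand bs" and "n = sum_list a"
  from assms have *: "a \<noteq> []" "in_T_list a" "in_T_list b" "sum_list b = n" "sort a \<noteq> sort b"
      "sort (omega_list a) \<noteq> sort (omega_list b)"
      "alpha_list (omega_list a) (expand ms) b" "alpha_list (omega_list b) (expand ns) a"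
    unfolding w by (auto simp: Let_def a_def b_def n_def)
  have T: "mset a \<in> T_parts n" "mset b \<in> T_parts n"
    using in_T_listD[of a] in_T_listD[of b] * by (auto simp: n_def)
  have "0 < n"
    using * by (cases a) (auto simp: n_def in_T_list_def)
  have S: "omega_move (mset a) \<in> S_parts n" "omega_move (mset b) \<in> S_parts n"
    using T \<open>0 < n\<close> by (auto intro: omega_move_in_S_parts)
  have "alpha_move n (omega_move (mset a)) (mset b)" "alpha_move n (omega_move (mset b)) (mset a)"
    using alpha_listD[OF *(7)] alpha_listD[OF *(8)] S T by (simp_all add: mset_omega_list)
  moreover have "mset a \<noteq> mset b" "omega_move (mset a) \<noteq> omega_move (mset b)"
    using * unfolding mset_omega_list[symmetric] mset_eq_iff_sort_eq by auto
  ultimately show ?thesis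
    using has_4_cycleI unfolding w n_def a_def by simp
qed

lemma has_4_cycle_sporadic:
  assumes "n \<in> {74, 75, 76, 77, 78, 79, 81, 83, 85, 94, 97, 99, 101, 103, 105, 107, 109, 111, 129, 131, 139, 141}"
  shows "has_k_cycle (with_proj (floridian_graph n)) 4"
proof -
  have "n \<in> set (map (\<lambda>w. sum_list (expand (fst w))) sporadic)"
    unfolding sums_sporadic using assms by simp
  then show ?thesis
    using list_all_witness_sporadic has_4_cycle_witness by (auto simp: list_all_iff)
qed

section \<open>The sums that staircases reach\<close>

text \<open>
  The bounds are the sums of the \<open>k\<close> smallest and of the \<open>k\<close> largest members of \<open>{1..L}\<close>, doubled. In
  the induction step the largest member \<open>L + 1\<close> is used only if \<open>k\<close> smaller ones do not suffice.
\<close>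
lemma subset_sum_exists:
  assumes "k \<le> L" and "k * (k + 1) \<le> 2 * t" and "2 * t + k * k \<le> k * (2 * L + 1)"
  shows "\<exists>A\<subseteq>{..<L}. card A = k \<and> (\<Sum>g\<in>A. Suc g) = t"
  using assms
proof (induction L arbitrary: k t)
  case 0
  then show ?case by auto
next
  case (Suc L)
  show ?case
  proof (cases k)
    case 0
    with Suc.prems show ?thesis by (intro exI[of _ "{}"]) auto
  next
    case (Suc j)
    show ?thesis
    proof (cases "k \<le> L \<and> 2 * t + k * k \<le> k * (2 * L + 1)")
      case True
      then obtain A where "A \<subseteq> {..<L}" "card A = k" "(\<Sum>g\<in>A. Suc g) = t"
        using Suc.IH[of k t] Suc.prems by blast
      moreover from this have "A \<subseteq> {..<Suc L}" by auto
      ultimately show ?thesis by blast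
    next
      case False
      have "j \<le> L" using Suc Suc.prems by simp
      have bounds: "L + 1 \<le> t \<and> j * (j + 1) \<le> 2 * (t - (L + 1))"
      proof (cases "k \<le> L")
        case True
        \<comment> \<open>The inequality is off by one without the parity of \<open>j * (j + 1)\<close>.\<close>
        obtain m where m: "j * (j + 1) = 2 * m" by (metis even_mult_iff even_plus_one_iff evenE)
        obtain d where d: "L = j + 1 + d" using True Suc le_Suc_ex by force
        have "k * (2 * L + 1) < 2 * t + k * k" using False True by simp
        then have "j * j + 3 * j + 2 + 2 * (j * d) + 2 * d < 2 * t"
          unfolding Suc d by (simp add: algebra_simps)
        moreover have "j * j + j = 2 * m" using m by simp
        ultimately have "m + j + d + 2 \<le> t" by linarith
        then show ?thesis unfolding m d by simp
      next
        case False
        then have "j = L" using Suc \<open>j \<le> L\<close> by simp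
        then show ?thesis using Suc.prems Suc by (simp add: algebra_simps)
      qed
      moreover have "2 * (t - (L + 1)) + j * j \<le> j * (2 * L + 1)"
        using Suc.prems(3) bounds unfolding Suc by (simp add: algebra_simps)
      ultimately obtain A where A: "A \<subseteq> {..<L}" "card A = j" "(\<Sum>g\<in>A. Suc g) = t - (L + 1)"
        using Suc.IH[of j "t - (L + 1)"] \<open>j \<le> L\<close> by blast
      then have "finite A" "L \<notin> A" using finite_subset by auto
      then have "insert L A \<subseteq> {..<Suc L}" "card (insert L A) = k" "(\<Sum>g\<in>insert L A. Suc g) = t"
        using A bounds Suc by auto
      then show ?thesis by blast
    qed
  qed
qed

lemma has_4_cycle_family:
  assumes "1 \<le> \<alpha>" "\<alpha> \<le> K" "\<alpha> \<le> R - K" "1 \<le> \<beta>" "\<beta> \<le> K" "\<beta> \<le> R - K"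
    and "\<alpha> * (\<alpha> + 1) \<le> 2 * u" "2 * u + \<alpha> * \<alpha> \<le> \<alpha> * (2 * (R - K) + 1)"
    and "\<beta> * (\<beta> + 1) \<le> 2 * v" "2 * v + \<beta> * \<beta> \<le> \<beta> * (2 * (R - K) + 1)"
    and "n + 1 = 2 * (R + 1)\<^sup>2 + 2 * (u + v) + \<alpha>\<^sup>2 + (\<beta> + 1)\<^sup>2"
  shows "has_k_cycle (with_proj (floridian_graph n)) 4"
proof -
  obtain A where "A \<subseteq> {..<R - K}" "card A = \<alpha>" "(\<Sum>g\<in>A. Suc g) = u"
    using subset_sum_exists[of \<alpha> "R - K" u] assms by auto
  moreover obtain B where "B \<subseteq> {..<R - K}" "card B = \<beta>" "(\<Sum>g\<in>B. Suc g) = v"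
    using subset_sum_exists[of \<beta> "R - K" v] assms by auto
  ultimately show ?thesis
    using assms by (intro has_4_cycle_staircase[of A R K B]) simp_all
qed

text \<open>
  In the four families below, \<open>t\<close> is split greedily: the share of \<open>B\<close> is as large as the minimal share
  of \<open>A\<close> and the maximal sum for \<open>B\<close> permit. The digits in the names are \<open>\<alpha>\<close> and \<open>\<beta>\<close>.
\<close>
lemma has_4_cycle_1_1:
  assumes "2 \<le> t" "t + 2 \<le> 2 * R" "n = 2 * (R + 1)\<^sup>2 + 2 * t + 4"
  shows "has_k_cycle (with_proj (floridian_graph n)) 4"
  using assms by (intro has_4_cycle_family[of 1 1 R 1 "t - min (t - 1) (R - 1)" "min (t - 1) (R - 1)"])
    (auto simp: power2_eq_square)

lemma has_4_cycle_2_2: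
  assumes "6 \<le> t" "t + 10 \<le> 4 * R" "n = 2 * (R + 1)\<^sup>2 + 2 * t + 12"
  shows "has_k_cycle (with_proj (floridian_graph n)) 4"
  using assms by (intro has_4_cycle_family[of 2 2 R 2 "t - min (t - 3) (2 * R - 5)" "min (t - 3) (2 * R - 5)"])
    (auto simp: power2_eq_square)

lemma has_4_cycle_2_1:
  assumes "4 \<le> t" "t + 7 \<le> 3 * R" "n = 2 * (R + 1)\<^sup>2 + 2 * t + 7"
  shows "has_k_cycle (with_proj (floridian_graph n)) 4"
  using assms by (intro has_4_cycle_family[of 2 2 R 1 "t - min (t - 3) (R - 2)" "min (t - 3) (R - 2)"])
    (auto simp: power2_eq_square min_def; linarith)+

lemma has_4_cycle_3_2:
  assumes "9 \<le> t" "t + 19 \<le> 5 * R" "n = 2 * (R + 1)\<^sup>2 + 2 * t + 17"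
  shows "has_k_cycle (with_proj (floridian_graph n)) 4"
  using assms by (intro has_4_cycle_family[of 3 3 R 2 "t - min (t - 6) (2 * R - 7)" "min (t - 6) (2 * R - 7)"])
    (auto simp: power2_eq_square min_def; linarith)+

lemma between_squares:
  fixes c n R\<^sub>0 :: nat
  assumes "2 * (R\<^sub>0 + 1)\<^sup>2 + c \<le> n"
  obtains R d where "R\<^sub>0 \<le> R" "n = 2 * (R + 1)\<^sup>2 + c + d" "d < 4 * R + 6"
proof -
  let ?P = "\<lambda>r. n < 2 * (R\<^sub>0 + r + 2)\<^sup>2 + c"
  have "?P n" by (simp add: power2_eq_square)
  then obtain r where r: "?P r" "\<And>i. i < r \<Longrightarrow> \<not> ?P i"
    using exists_least_iff[of ?P] by blast
  have "2 * (R\<^sub>0 + r + 1)\<^sup>2 + c \<le> n"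
    using assms r(2)[of "r - 1"] by (cases r) auto
  then obtain d where "n = 2 * (R\<^sub>0 + r + 1)\<^sup>2 + c + d" using le_Suc_ex by blast
  moreover from this r(1) have "d < 4 * (R\<^sub>0 + r) + 6" by (simp add: power2_eq_square algebra_simps)
  ultimately show ?thesis using that[of "R\<^sub>0 + r" d] by simp
qed

text \<open>
  For even \<open>n\<close> the constant \<open>8\<close> is the smallest excess over \<open>2 * (R + 1)\<^sup>2\<close> that the family \<open>(1, 1)\<close>
  reaches, and for odd \<open>n\<close> the constant \<open>15\<close> is that of \<open>(2, 1)\<close>. Once \<open>R \<ge> 7\<close>, the second family has
  started before the first one ends, and it continues up to the start of the first family for \<open>R + 1\<close>.
\<close>
theorem theorem28:
  fixes n :: nat
  assumes "n > 73"
  shows "has_k_cycle (with_proj (floridian_graph n)) 4"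
proof (cases "n \<in> {74, 75, 76, 77, 78, 79, 81, 83, 85, 94, 97, 99, 101, 103, 105, 107, 109, 111, 129, 131, 139, 141}")
  case True
  then show ?thesis by (rule has_4_cycle_sporadic)
next
  case not_sporadic: False
  show ?thesis
  proof (cases "even n")
    case True
    have "80 \<le> n"
      using not_sporadic \<open>n > 73\<close> True by (simp; presburger)
    then obtain R d where R: "5 \<le> R" "n = 2 * (R + 1)\<^sup>2 + 8 + d" "d < 4 * R + 6"
      using between_squares[of 5 8 n] by auto
    then obtain e where e: "d = 2 * e"
      using True by (auto elim: evenE)
    show ?thesis
    proof (cases "e + 4 \<le> 2 * R")
      case True
      then show ?thesis
        using R e by (intro has_4_cycle_1_1[of "e + 2" R]) auto
    next
      case False
      \<comment> \<open>This is the gap at \<open>n = 94\<close>.\<close>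
      have "R \<noteq> 5 \<or> e \<noteq> 7" using not_sporadic R(2) e by (auto simp: power2_eq_square)
      then have "8 \<le> e" using False R(1) by linarith
      then show ?thesis
        using R e by (intro has_4_cycle_2_2[of "e - 2" R]) auto
    qed
  next
    case odd: False
    have "87 \<le> n"
      using not_sporadic \<open>n > 73\<close> odd by (simp; presburger)
    then obtain R d where R: "5 \<le> R" "n = 2 * (R + 1)\<^sup>2 + 15 + d" "d < 4 * R + 6"
      using between_squares[of 5 15 n] by auto
    then obtain e where e: "d = 2 * e"
      using odd by (auto elim: evenE)
    show ?thesis
    proof (cases "e + 11 \<le> 3 * R")
      case True
      then show ?thesis
        using R e by (intro has_4_cycle_2_1[of "e + 4" R]) auto
    next
      case False
      have "10 \<le> e \<and> e + 18 \<le> 5 * R"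
      proof (cases "7 \<le> R")
        case True
        then show ?thesis using False R e by linarith
      next
        case 2: False
        \<comment> \<open>For such small \<open>R\<close> the two families do not meet, and what lies between them is sporadic.\<close>
        then have "R = 5 \<or> R = 6" using R(1) by linarith
        then show ?thesis
        proof
          assume "R = 5"
          moreover have "e \<in> {5..12}" using False R e \<open>R = 5\<close> by auto
          ultimately show ?thesis using not_sporadic R(2) e by (simp add: power2_eq_square; presburger)
        next
          assume "R = 6"
          then show ?thesis using not_sporadic R(2,3) e False by (simp add: power2_eq_square; presburger)
        qed
      qed
      then show ?thesis
        using R e by (intro has_4_cycle_3_2[of "e - 1" R]) auto
    qed
  qed
qed

end
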